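(* Let $$T = \{1, 2, 5, 7, 10, 11, 13, 14, 17, 19, 22, 23, 26, 29, 31, 34, 35, 37, 38, 46, 47, 55, 58, 62, 70, 94, 110, 119, 145, 203, 290\}.$$ For every $t \in T$ there is a positive-definite integer-valued quadratic form $Q$ (in some number of variables) that represents every positive integer coprime to $3$ except $t$; that is, $Q$ does not represent $t$, and $Q$ represents every positive integer $n \neq t$ with $\gcd(n,3) = 1$.
   Context: A quadratic form $Q$ in $r$ variables is integer-valued if $Q(\vec{x}) = \frac{1}{2}\vec{x}^{T} A \vec{x}$ where $A$ is a symmetric $r \times r$ matrix with integer entries and even diagonal entries (equivalently, $Q$ is a homogeneous quadratic polynomial with integer coefficients). $Q$ is positive-definite if $Q(\vec{x}) > 0$ for all nonzero $\vec{x} \in \mathbb{R}^{r}$. $Q$ represents an integer $n$ if there is $\vec{x} \in \mathbb{Z}^{r}$ with $Q(\vec{x}) = n$. *)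

theory Defs
  imports "Jordan_Normal_Form.Matrix"
begin

text \<open>
  The number of variables has to be existentially quantified, so vectors are those of
  \<^typ>\<open>real vec\<close> with \<^term>\<open>carrier_vec r\<close> as the space of all vectors of
  length \<open>r\<close>. A form in \<open>r\<close> variables is a function whose values matter only on
  \<^term>\<open>carrier_vec r\<close>.
\<close>

definition integer_valued_quadratic_form :: "nat \<Rightarrow> (real vec \<Rightarrow> real) \<Rightarrow> bool" where
  "integer_valued_quadratic_form r Q \<longleftrightarrow>
     (\<exists>A :: int mat. A \<in> carrier_mat r r \<and> A\<^sup>T = A \<and> (\<forall>i<r. even (A $$ (i, i))) \<and>
        (\<forall>x \<in> carrier_vec r. Q x = 1 / 2 * (x \<bullet> (map_mat real_of_int A *\<^sub>v x))))"

definition positive_definite :: "nat \<Rightarrow> (real vec \<Rightarrow> real) \<Rightarrow> bool" where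
  "positive_definite r Q \<longleftrightarrow> (\<forall>x \<in> carrier_vec r. x \<noteq> 0\<^sub>v r \<longrightarrow> Q x > 0)"

definition represents :: "nat \<Rightarrow> (real vec \<Rightarrow> real) \<Rightarrow> int \<Rightarrow> bool" where
  "represents r Q n \<longleftrightarrow>
     (\<exists>x :: int vec. x \<in> carrier_vec r \<and> Q (map_vec real_of_int x) = real_of_int n)"

end

theory Submission
  imports Defs "HOL-Computational_Algebra.Primes"
begin

text \<open>
  The problem is finite for each \<open>t\<close>, because the integers above \<open>t\<close> can be supplied without
  disturbing \<open>t\<close>. Let \<open>M\<close> be the diagonal form with the coefficient \<open>t + 1\<close> four times and
  each of \<open>t + 2, \<dots>, 2 t + 1\<close> once. Every nonzero value of \<open>M\<close> exceeds \<open>t\<close>, and by Lagrange's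
  four-square theorem \<open>M\<close> represents every \<open>n > t\<close>: the four squares give any multiple of
  \<open>t + 1\<close>, and one further coefficient, if necessary, corrects the residue. So if \<open>q\<close> is a
  positive-definite form that misses \<open>t\<close> and represents every positive \<open>n < t\<close> prime to 3, then
  \<open>M \<oplus> q\<close> has the required property: a representation of \<open>t\<close> by it would have to vanish on
  \<open>M\<close> and hence come from \<open>q\<close>. This is lemma \<open>single_exception_form\<close>.

  What remains is one such \<open>q\<close> for each \<open>t\<close>. It is given through a multiple \<open>N q\<close> written as a
  sum of squares with positive coefficients, each square introducing one new variable (Lagrange's
  reduction). Such an identity shows that \<open>q\<close> is positive definite, and it makes the equation
  \<open>q x = n\<close> a finite search: running through the variables from the last to the first, every
  square leaves only finitely many values for its own variable, and the first variable is decided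
  by a test for perfect squares. The search \<open>attains\<close> is proved correct in \<open>attains_iff\<close> and then
  run by rewriting, once for \<open>t\<close> and once for each smaller \<open>n\<close> prime to 3.
\<close>

section \<open>Four squares\<close>

definition sum_of_four_squares :: "int \<Rightarrow> bool" where
  "sum_of_four_squares n \<longleftrightarrow> (\<exists>a b c d. n = a^2 + b^2 + c^2 + d^2)"

lemma euler_four_square_identity:
  fixes a b c d x y z w :: int
  shows "(a^2 + b^2 + c^2 + d^2) * (x^2 + y^2 + z^2 + w^2) =
    (a*x + b*y + c*z + d*w)^2 + (a*y - b*x + c*w - d*z)^2 +
    (a*z - c*x + d*y - b*w)^2 + (a*w - d*x + b*z - c*y)^2"
  by (simp add: power2_eq_square algebra_simps)

lemma sum_of_four_squares_mult:
  assumes "sum_of_four_squares m" "sum_of_four_squares n"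
  shows "sum_of_four_squares (m * n)"
  using assms unfolding sum_of_four_squares_def by (metis euler_four_square_identity)

text \<open>
  Pigeonhole: for \<open>0 \<le> x, y \<le> (p - 1) / 2\<close> the squares \<open>x^2\<close> are pairwise incongruent, and
  so are the numbers \<open>- 1 - y^2\<close>. Together these are \<open>p + 1\<close> numbers, so two of them agree
  modulo \<open>p\<close>.
\<close>
lemma two_squares_cong_minus_one:
  fixes p :: int
  assumes "prime p" "odd p"
  shows "\<exists>x y. p dvd x^2 + y^2 + 1 \<and> 0 \<le> x \<and> 2 * x < p \<and> 0 \<le> y \<and> 2 * y < p"
proof -
  define h where "h = (p - 1) div 2"
  have p: "p = 2 * h + 1" "h \<ge> 0" using assms prime_gt_0_int[of p] by (auto simp: h_def elim!: oddE)
  have inj: "x = y" if "0 \<le> x" "x \<le> h" "0 \<le> y" "y \<le> h" "p dvd x^2 - y^2" for x y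
  proof -
    have "p dvd (x - y) * (x + y)" using that(5) by (simp add: power2_eq_square algebra_simps)
    then consider "p dvd x - y" | "p dvd x + y" using assms(1) prime_dvd_mult_iff by blast
    then show ?thesis
    proof cases
      case 1
      then show ?thesis using that p dvd_imp_le_int[of "x - y" p] by (cases "x = y") auto
    next
      case 2
      then show ?thesis using that p dvd_imp_le_int[of "x + y" p] by (cases "x + y = 0") auto
    qed
  qed
  define A where "A = (\<lambda>x. x^2 mod p) ` {0..h}"
  define B where "B = (\<lambda>y. (- 1 - y^2) mod p) ` {0..h}"
  have "card A = card {0..h}" unfolding A_def
    by (rule card_image) (auto intro!: inj_onI inj simp: mod_eq_dvd_iff)
  moreover have "inj_on (\<lambda>y. (- 1 - y^2) mod p) {0..h}"
    by (auto intro!: inj_onI inj simp: mod_eq_dvd_iff dvd_diff_commute)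
  then have "card B = card {0..h}" unfolding B_def by (rule card_image)
  moreover have "A \<union> B \<subseteq> {0..<p}"
    using prime_gt_0_int[OF assms(1)] by (auto simp: A_def B_def)
  then have "card (A \<union> B) \<le> card {0..<p}" by (intro card_mono) auto
  moreover have fin: "finite A" "finite B" by (auto simp: A_def B_def)
  ultimately have "A \<inter> B \<noteq> {}"
    using p card_Un_disjoint[of A B] by auto
  then obtain x y where xy: "0 \<le> x" "x \<le> h" "0 \<le> y" "y \<le> h" "x^2 mod p = (- 1 - y^2) mod p"
    by (auto simp: A_def B_def)
  then have "p dvd x^2 + y^2 + 1" by (simp add: mod_eq_dvd_iff algebra_simps)
  then show ?thesis using xy p by (intro exI[of _ x] exI[of _ y]) auto
qed

text \<open>
  An even sum of four squares has an even number of odd terms, so the terms fall into two pairs of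
  equal parity; then \<open>((a + b)/2)^2 + ((a - b)/2)^2\<close> is half of \<open>a^2 + b^2\<close>.
\<close>
lemma sum_of_four_squares_half:
  assumes "sum_of_four_squares (2 * n)"
  shows "sum_of_four_squares n"
proof -
  have pair: "sum_of_four_squares n"
    if "2 * n = a^2 + b^2 + c^2 + d^2" "even (a + b)" "even (c + d)" for a b c d :: int
  proof -
    obtain u v where u: "a + b = 2 * u" and v: "c + d = 2 * v"
      using \<open>even (a + b)\<close> \<open>even (c + d)\<close> by (elim evenE)
    have a: "a = 2 * u - b" "c = 2 * v - d" using u v by auto
    have "2 * n = 2 * (u^2 + (u - b)^2 + v^2 + (v - d)^2)"
      using that(1) unfolding a by (simp add: power2_eq_square algebra_simps)
    then have "n = u^2 + (u - b)^2 + v^2 + (v - d)^2"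
      by (metis mult_cancel_left zero_neq_numeral)
    then show ?thesis unfolding sum_of_four_squares_def by blast
  qed
  obtain a b c d where eq: "2 * n = a^2 + b^2 + c^2 + d^2"
    using assms unfolding sum_of_four_squares_def by auto
  have "even (a^2 + b^2 + c^2 + d^2)" by (simp flip: eq)
  then have "even (a + b + c + d)" by simp
  then consider "even (a + b)" "even (c + d)" | "even (a + c)" "even (b + d)" | "even (a + d)" "even (b + c)"
    by (auto; fail)
  then show ?thesis
    by cases (use pair[of a b c d] pair[of a c b d] pair[of a d b c] eq in \<open>auto simp: algebra_simps\<close>)
qed

lemma centered_residue:
  fixes m x :: int
  assumes "odd m" "m > 0"
  shows "\<exists>y. m dvd x - y \<and> 2 * \<bar>y\<bar> < m"
proof -
  define h where "h = m div 2"
  have m: "m = 2 * h + 1" using assms by (auto simp: h_def)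
  define r where "r = (x + h) mod m"
  have "m dvd x - (r - h)"
    using dvd_minus_mod[of m "x + h"] by (simp add: r_def algebra_simps)
  moreover have "0 \<le> r" "r < m" using assms(2) by (auto simp: r_def)
  then have "2 * \<bar>r - h\<bar> < m" using m by arith
  ultimately show ?thesis by blast
qed

text \<open>
  For odd \<open>m\<close>, reduce the four roots modulo \<open>m\<close> to absolute value below \<open>m / 2\<close>. The
  reduced squares sum to \<open>m r\<close> with \<open>r < m\<close>. In the product of both sums, expanded by Euler's
  identity, every root is divisible by \<open>m\<close>; dividing by \<open>m^2\<close> leaves \<open>r p\<close>. Oddness makes the
  bound on the residues strict, which is what gives \<open>r < m\<close>; an even \<open>m\<close> is halved instead.
\<close>
lemma four_square_descent:
  fixes p m :: int
  assumes "prime p" "1 < m" "m < p" "sum_of_four_squares (m * p)"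
  shows "\<exists>r. 0 < r \<and> r < m \<and> sum_of_four_squares (r * p)"
proof (cases "even m")
  case True
  then obtain k where "m = 2 * k" by (elim evenE)
  then show ?thesis using assms sum_of_four_squares_half[of "k * p"]
    by (intro exI[of _ k]) (auto simp: mult.assoc)
next
  case False
  obtain a b c d where abcd: "m * p = a^2 + b^2 + c^2 + d^2"
    using assms(4) unfolding sum_of_four_squares_def by auto
  obtain x y z w where
    x: "m dvd a - x" "2 * \<bar>x\<bar> < m" and y: "m dvd b - y" "2 * \<bar>y\<bar> < m" and
    z: "m dvd c - z" "2 * \<bar>z\<bar> < m" and w: "m dvd d - w" "2 * \<bar>w\<bar> < m"
    using centered_residue[OF False, of a] centered_residue[OF False, of b]
      centered_residue[OF False, of c] centered_residue[OF False, of d] assms(2) by auto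
  obtain a' b' c' d' where "a - x = m * a'" "b - y = m * b'" "c - z = m * c'" "d - w = m * d'"
    using x(1) y(1) z(1) w(1) by (elim dvdE)
  then have s: "a = x + m * a'" "b = y + m * b'" "c = z + m * c'" "d = w + m * d'" by auto
  have "x^2 + y^2 + z^2 + w^2 = m * (p - (2*x*a' + m*a'^2 + 2*y*b' + m*b'^2 + 2*z*c' + m*c'^2 + 2*w*d' + m*d'^2))"
    using abcd unfolding s by (simp add: power2_eq_square algebra_simps)
  then obtain r where r: "x^2 + y^2 + z^2 + w^2 = m * r" by blast
  have sq: "4 * u^2 < m^2" if "2 * \<bar>u\<bar> < m" for u
  proof -
    have "(2 * \<bar>u\<bar>)^2 < m^2" using that by (intro power_strict_mono) auto
    then show ?thesis by (simp add: power_mult_distrib)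
  qed
  have "4 * (m * r) < 4 * m^2" using sq[OF x(2)] sq[OF y(2)] sq[OF z(2)] sq[OF w(2)] r by linarith
  then have "r < m" using assms(2) by (simp add: power2_eq_square)
  have "m * r \<ge> 0" by (simp flip: r)
  then have "r \<ge> 0" using assms(2) by (simp add: zero_le_mult_iff)
  \<comment> \<open>otherwise all four roots are multiples of \<open>m\<close>, so \<open>m\<close> is a proper divisor of \<open>p\<close>\<close>
  have "r \<noteq> 0"
  proof
    assume "r = 0"
    then have "x^2 + y^2 + z^2 + w^2 = 0" using r by simp
    moreover have "x^2 \<ge> 0" "y^2 \<ge> 0" "z^2 \<ge> 0" "w^2 \<ge> 0" by auto
    ultimately have "x^2 = 0" "y^2 = 0" "z^2 = 0" "w^2 = 0" by linarith+
    then have "m * p = m * (m * (a'^2 + b'^2 + c'^2 + d'^2))"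
      unfolding abcd s by (simp add: power2_eq_square algebra_simps)
    then have "m dvd p" using assms(2) by auto
    moreover have "0 \<le> m" using assms(2) by simp
    ultimately have "m = 1 \<or> m = p" using assms(1) unfolding prime_int_iff by blast
    then show False using assms(2,3) by simp
  qed
  have "m^2 * (r * p) = (a^2 + b^2 + c^2 + d^2) * (x^2 + y^2 + z^2 + w^2)"
    using abcd r by (simp add: power2_eq_square)
  also have "\<dots> = (a*x + b*y + c*z + d*w)^2 + (a*y - b*x + c*w - d*z)^2 +
      (a*z - c*x + d*y - b*w)^2 + (a*w - d*x + b*z - c*y)^2"
    by (rule euler_four_square_identity)
  also have "a*x + b*y + c*z + d*w = m * (r + a'*x + b'*y + c'*z + d'*w)"
    using r unfolding s by (simp add: power2_eq_square algebra_simps)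
  also have "a*y - b*x + c*w - d*z = m * (a'*y - b'*x + c'*w - d'*z)"
    unfolding s by (simp add: algebra_simps)
  also have "a*z - c*x + d*y - b*w = m * (a'*z - c'*x + d'*y - b'*w)"
    unfolding s by (simp add: algebra_simps)
  also have "a*w - d*x + b*z - c*y = m * (a'*w - d'*x + b'*z - c'*y)"
    unfolding s by (simp add: algebra_simps)
  finally have "sum_of_four_squares (r * p)"
    using assms(2) unfolding sum_of_four_squares_def
    by (simp add: power_mult_distrib flip: distrib_left) blast
  then show ?thesis using \<open>r < m\<close> \<open>r \<ge> 0\<close> \<open>r \<noteq> 0\<close> by (intro exI[of _ r]) auto
qed

lemma prime_sum_of_four_squares:
  fixes p :: int
  assumes "prime p"
  shows "sum_of_four_squares p"
proof (cases "odd p")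
  case False
  then have "p = 2" using assms primes_dvd_imp_eq[of 2 p] by simp
  show ?thesis unfolding sum_of_four_squares_def \<open>p = 2\<close>
    by (rule exI[of _ 1], rule exI[of _ 1], rule exI[of _ 0], rule exI[of _ 0]) simp
next
  case True
  have "p > 1" using assms prime_gt_1_int by blast
  have descend: "sum_of_four_squares p"
    if "0 < m" "m < p" "sum_of_four_squares (m * p)" for m
    using that
  proof (induction "nat m" arbitrary: m rule: less_induct)
    case less
    show ?case
    proof (cases "m = 1")
      case False
      then obtain r where "0 < r" "r < m" "sum_of_four_squares (r * p)"
        using four_square_descent[OF assms, of m] less.prems by auto
      then show ?thesis using less.hyps[of r] less.prems by auto
    qed (use less.prems in auto)
  qed
  obtain x y where xy: "p dvd x^2 + y^2 + 1" "0 \<le> x" "2 * x < p" "0 \<le> y" "2 * y < p"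
    using two_squares_cong_minus_one[OF assms True] by auto
  then obtain m where m: "x^2 + y^2 + 1 = m * p" by (auto elim!: dvdE simp: mult.commute)
  have "(2 * x)^2 \<le> (p - 1)^2" "(2 * y)^2 \<le> (p - 1)^2" using xy by (intro power_mono; auto)+
  then have "4 * (m * p) \<le> 2 * (p - 1)^2 + 4" using m by (simp add: power_mult_distrib)
  also have "\<dots> < 4 * (p * p)" using \<open>p > 1\<close> mult_strict_mono[of 1 p 1 p]
    by (simp add: power2_eq_square algebra_simps)
  finally have "m < p" using \<open>p > 1\<close> by simp
  have "m * p > 0" by (simp add: add_nonneg_pos flip: m)
  then have "m > 0" using \<open>p > 1\<close> by (simp add: zero_less_mult_iff)
  moreover have "sum_of_four_squares (m * p)" unfolding sum_of_four_squares_def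
    by (intro exI[of _ x] exI[of _ y] exI[of _ 1] exI[of _ 0]) (simp add: m)
  ultimately show ?thesis using descend \<open>m < p\<close> by blast
qed

lemma lagrange_four_squares:
  fixes n :: int
  assumes "n \<ge> 0"
  shows "sum_of_four_squares n"
proof -
  have zero: "sum_of_four_squares 0" unfolding sum_of_four_squares_def
    by (rule exI[of _ 0])+ simp
  have one: "sum_of_four_squares 1" unfolding sum_of_four_squares_def
    by (rule exI[of _ 1], (rule exI[of _ 0])+) simp
  have "sum_of_four_squares (int k)" for k
  proof (induction k rule: prime_divisors_induct)
    case (factor p k)
    then show ?case using prime_sum_of_four_squares[of "int p"] sum_of_four_squares_mult by simp
  qed (use zero one in auto)
  from this[of "nat n"] show ?thesis using assms by simp
qed


section \<open>Forms with triangular integer coefficients\<close>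

fun linear_form :: "int list \<Rightarrow> 'a::comm_ring_1 list \<Rightarrow> 'a" where
  "linear_form (b # bs) (x # xs) = of_int b * x + linear_form bs xs"
| "linear_form _ _ = 0"

lemma linear_form_zero: "set xs \<subseteq> {0} \<Longrightarrow> linear_form b xs = 0"
  by (induction b xs rule: linear_form.induct) auto

text \<open>
  A form is stored as the rows of its upper triangle: the pair \<open>(a, b)\<close> of the leading variable
  \<open>x\<close> stands for \<open>a x^2\<close> and for the products of \<open>x\<close> with the later variables, where missing
  coefficients count as zero. Integer coefficients in this shape are exactly what makes a form
  integer-valued, so no evenness condition has to be carried along.
\<close>
type_synonym coeffs = "(int \<times> int list) list"

fun quad_form :: "coeffs \<Rightarrow> 'a::comm_ring_1 list \<Rightarrow> 'a" where
  "quad_form ((a, b) # q) (x # xs) = of_int a * x^2 + x * linear_form b xs + quad_form q xs"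
| "quad_form _ _ = 0"

lemma linear_form_of_int: "linear_form b (map of_int xs) = of_int (linear_form b xs)"
  by (induction b xs rule: linear_form.induct)
    (simp_all only: linear_form.simps list.map of_int_add of_int_mult of_int_0 of_int_eq_id id_apply)

lemma quad_form_of_int: "quad_form q (map of_int xs) = of_int (quad_form q xs)"
  by (induction q xs rule: quad_form.induct)
    (simp_all only: quad_form.simps linear_form_of_int list.map of_int_add of_int_mult of_int_power
      of_int_0 of_int_eq_id id_apply)

definition coeff_at :: "int list \<Rightarrow> nat \<Rightarrow> int" where
  "coeff_at b j = (if j < length b then b ! j else 0)"

lemma coeff_at_simps [simp]:
  "coeff_at [] j = 0" "coeff_at (c # b) 0 = c" "coeff_at (c # b) (Suc j) = coeff_at b j"
  by (simp_all add: coeff_at_def)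

lemma quad_form_zero: "set xs \<subseteq> {0} \<Longrightarrow> quad_form q xs = 0"
  by (induction q xs rule: quad_form.induct) (simp_all add: linear_form_zero)

text \<open>
  The symmetric matrix \<open>A\<close> with \<open>q x = (1/2) x\<^sup>T A x\<close>.
\<close>
primrec gram_entry :: "coeffs \<Rightarrow> nat \<Rightarrow> nat \<Rightarrow> int" where
  "gram_entry [] i j = 0"
| "gram_entry (r # q) i j =
     (case i of 0 \<Rightarrow> (case j of 0 \<Rightarrow> 2 * fst r | Suc j' \<Rightarrow> coeff_at (snd r) j')
      | Suc i' \<Rightarrow> (case j of 0 \<Rightarrow> coeff_at (snd r) i' | Suc j' \<Rightarrow> gram_entry q i' j'))"

lemma gram_entry_sym: "gram_entry q i j = gram_entry q j i"
proof (induction q arbitrary: i j)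
  case (Cons r q)
  then show ?case by (cases r) (auto split: nat.split)
qed simp

lemma even_gram_entry_diag: "even (gram_entry q i i)"
proof (induction q arbitrary: i)
  case (Cons r q)
  then show ?case by (cases r) (auto split: nat.split)
qed simp

lemma linear_form_conv_sum:
  "linear_form b xs = (\<Sum>j<length xs. of_int (coeff_at b j) * xs ! j)"
  by (induction b xs rule: linear_form.induct)
     (auto simp del: sum.lessThan_Suc simp: sum.lessThan_Suc_shift)

lemma two_quad_form_conv_sum:
  "length xs = length q \<Longrightarrow>
     2 * quad_form q xs = (\<Sum>i<length q. \<Sum>j<length q. of_int (gram_entry q i j) * xs ! i * xs ! j)"
proof (induction q xs rule: quad_form.induct)
  case (1 a b q x xs)
  then have len: "length xs = length q" by simp
  have row: "(\<Sum>j<length q. x * (xs ! j * of_int (coeff_at b j))) = x * linear_form b xs"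
    by (simp add: linear_form_conv_sum len sum_distrib_left algebra_simps)
  show ?case
    using 1 by (simp del: sum.lessThan_Suc add: sum.lessThan_Suc_shift sum.distrib power2_eq_square algebra_simps row)
qed auto

definition real_form :: "coeffs \<Rightarrow> real vec \<Rightarrow> real" where
  "real_form q x = quad_form q (list_of_vec x)"

lemma integer_valued_real_form: "integer_valued_quadratic_form (length q) (real_form q)"
  unfolding integer_valued_quadratic_form_def
proof (intro exI[of _ "mat (length q) (length q) (\<lambda>(i, j). gram_entry q i j)"] conjI ballI allI impI)
  fix x :: "real vec" assume x: "x \<in> carrier_vec (length q)"
  define n where "n = length q"
  have len: "length (list_of_vec x) = length q" using x by simp
  have "x \<bullet> (map_mat real_of_int (mat n n (\<lambda>(i, j). gram_entry q i j)) *\<^sub>v x) =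
      (\<Sum>i<n. \<Sum>j<n. of_int (gram_entry q i j) * x $ i * x $ j)"
    using x by (simp add: scalar_prod_def n_def atLeast0LessThan sum_distrib_left algebra_simps)
  also have "\<dots> = 2 * quad_form q (list_of_vec x)"
    using x by (subst two_quad_form_conv_sum[OF len]) (auto simp: n_def list_of_vec_index)
  finally show "real_form q x = 1 / 2 * (x \<bullet> (map_mat real_of_int
      (mat (length q) (length q) (\<lambda>(i, j). gram_entry q i j)) *\<^sub>v x))"
    by (simp add: real_form_def n_def)
qed (auto simp: gram_entry_sym even_gram_entry_diag intro!: eq_matI)

lemma represents_real_form_iff:
  "represents (length q) (real_form q) n \<longleftrightarrow> (\<exists>xs. length xs = length q \<and> quad_form q xs = n)"
proof
  assume "represents (length q) (real_form q) n"
  then obtain x :: "int vec" where "x \<in> carrier_vec (length q)"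
    "quad_form q (list_of_vec (map_vec real_of_int x)) = real_of_int n"
    by (auto simp: represents_def real_form_def)
  moreover have "list_of_vec (map_vec real_of_int x) = map real_of_int (list_of_vec x)"
    by (rule nth_equalityI) (auto simp: list_of_vec_index)
  ultimately show "\<exists>xs. length xs = length q \<and> quad_form q xs = n"
    by (intro exI[of _ "list_of_vec x"]) (auto simp: quad_form_of_int)
next
  assume "\<exists>xs. length xs = length q \<and> quad_form q xs = n"
  then obtain xs where xs: "length xs = length q" "quad_form q xs = n" by auto
  have list: "list_of_vec (map_vec real_of_int (vec_of_list xs)) = map real_of_int xs"
    by (rule nth_equalityI) (auto simp: list_of_vec_index vec_of_list_index)
  show "represents (length q) (real_form q) n"
    unfolding represents_def
  proof (intro exI conjI)
    show "vec_of_list xs \<in> carrier_vec (length q)"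
      using xs(1) by (metis carrier_vec_dim_vec dim_vec_of_list)
    show "real_form q (map_vec real_of_int (vec_of_list xs)) = real_of_int n"
      unfolding real_form_def list quad_form_of_int xs(2) ..
  qed
qed

section \<open>Sums of squares of linear forms in echelon shape\<close>

text \<open>
  A row \<open>(f, m, b)\<close> stands for \<open>f (m x + b y)^2\<close>, where \<open>x\<close> is the variable of that row and
  \<open>y\<close> are the later ones. The coefficient \<open>m\<close> is kept separate because it has to be positive: this
  is what allows the variables to be solved for one after the other.
\<close>
type_synonym squares = "(int \<times> int \<times> int list) list"

fun sum_squares :: "squares \<Rightarrow> 'a::comm_ring_1 list \<Rightarrow> 'a" where
  "sum_squares ((f, m, b) # D) (x # xs) =
     of_int f * (of_int m * x + linear_form b xs)^2 + sum_squares D xs"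
| "sum_squares _ _ = 0"

definition positive_squares :: "squares \<Rightarrow> bool" where
  "positive_squares D \<longleftrightarrow> list_all (\<lambda>(f, m, b). 0 < f \<and> 0 < m) D"

lemma sum_squares_nonneg:
  fixes xs :: "'a::linordered_idom list"
  assumes "positive_squares D"
  shows "0 \<le> sum_squares D xs"
  using assms
  by (induction D xs rule: sum_squares.induct) (auto simp: positive_squares_def)


text \<open>
  All squares vanish; going backwards from the last row, each row forces its own variable to be zero.
\<close>
lemma sum_squares_eq_zeroD:
  fixes xs :: "'a::linordered_idom list"
  assumes "positive_squares D" "length xs = length D" "sum_squares D xs = 0"
  shows "set xs \<subseteq> {0}"
  using assms
proof (induction D xs rule: sum_squares.induct)
  case (1 f m b D x xs)
  have "positive_squares D" "f > 0" "m > 0" using 1 by (auto simp: positive_squares_def)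
  have "of_int f * (of_int m * x + linear_form b xs)^2 \<ge> 0" using \<open>f > 0\<close> by simp
  moreover have "sum_squares D xs \<ge> 0" using sum_squares_nonneg \<open>positive_squares D\<close> .
  ultimately have zero: "of_int f * (of_int m * x + linear_form b xs)^2 = 0" "sum_squares D xs = 0"
    using 1(4) by (simp_all only: sum_squares.simps add_nonneg_eq_0_iff)
  then have "set xs \<subseteq> {0}" using 1 \<open>positive_squares D\<close> by auto
  moreover have "of_int m * x + linear_form b xs = 0" using zero(1) \<open>f > 0\<close> by simp
  ultimately show ?case using \<open>m > 0\<close> by (simp add: linear_form_zero)
qed auto

fun add_coeffs :: "int list \<Rightarrow> int list \<Rightarrow> int list" where
  "add_coeffs (x # xs) (y # ys) = (x + y) # add_coeffs xs ys"
| "add_coeffs xs [] = xs"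
| "add_coeffs [] ys = ys"

lemma linear_form_add: "linear_form (add_coeffs b c) xs = linear_form b xs + linear_form c xs"
proof (induction b c arbitrary: xs rule: add_coeffs.induct)
  case (1 x xs y ys zs)
  then show ?case by (cases zs) (auto simp: algebra_simps)
qed auto

lemma linear_form_scale: "linear_form (map ((*) c) b) xs = of_int c * linear_form b xs"
  by (induction b xs rule: linear_form.induct) (auto simp: algebra_simps)

fun add_square :: "int \<Rightarrow> int list \<Rightarrow> coeffs \<Rightarrow> coeffs" where
  "add_square f (c # cs) ((a, b) # q) =
     (a + f * c * c, add_coeffs b (map ((*) (2 * f * c)) cs)) # add_square f cs q"
| "add_square f _ q = q"

lemma quad_form_add_square:
  "length xs = length q \<Longrightarrow>
     quad_form (add_square f b q) xs = quad_form q xs + of_int f * (linear_form b xs)^2"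
proof (induction f b q arbitrary: xs rule: add_square.induct)
  case (1 f c cs a b q)
  then obtain y ys where "xs = y # ys" "length ys = length q" by (cases xs) auto
  then show ?case using 1
    by (simp add: linear_form_add linear_form_scale power2_eq_square algebra_simps)
qed auto

lemma length_add_square [simp]: "length (add_square f b q) = length q"
  by (induction f b q rule: add_square.induct) auto

fun expand :: "squares \<Rightarrow> coeffs" where
  "expand [] = []"
| "expand ((f, m, b) # D) = (f * m * m, map ((*) (2 * f * m)) b) # add_square f b (expand D)"

lemma length_expand [simp]: "length (expand D) = length D"
  by (induction D rule: expand.induct) auto

lemma quad_form_expand: "length xs = length D \<Longrightarrow> quad_form (expand D) xs = sum_squares D xs"
proof (induction D xs rule: sum_squares.induct)
  case (1 f m b D x xs)
  then show ?case
    by (simp add: quad_form_add_square linear_form_scale power2_eq_square algebra_simps)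
qed auto

definition scale_coeffs :: "int \<Rightarrow> coeffs \<Rightarrow> coeffs" where
  "scale_coeffs c = map (\<lambda>(a, b). (c * a, map ((*) c) b))"

lemma quad_form_scale: "quad_form (scale_coeffs c q) xs = of_int c * quad_form q xs"
  by (induction q xs rule: quad_form.induct)
     (auto simp: scale_coeffs_def linear_form_scale algebra_simps)

text \<open>
  The floors are exact wherever this is applied: a certificate requires that multiplying by \<open>c\<close>
  restores the original coefficients.
\<close>
definition div_coeffs :: "int \<Rightarrow> coeffs \<Rightarrow> coeffs" where
  "div_coeffs c = map (\<lambda>(a, b). (a div c, map (\<lambda>y. y div c) b))"

section \<open>Deciding representability by search\<close>

text \<open>
  The integer square root, one binary digit per step: \<open>isqrt n\<close> is \<open>2 isqrt (n div 4)\<close> or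
  one more. It takes logarithmically many steps, which matters because it is evaluated by rewriting.
\<close>
fun isqrt :: "int \<Rightarrow> int" where
  "isqrt n = (if n \<le> 0 then 0
     else let r = 2 * isqrt (n div 4) in if (r + 1) * (r + 1) \<le> n then r + 1 else r)"

declare isqrt.simps [simp del]

lemma isqrt_bounds:
  "0 \<le> n \<Longrightarrow> 0 \<le> isqrt n \<and> isqrt n * isqrt n \<le> n \<and> n < (isqrt n + 1) * (isqrt n + 1)"
proof (induction n rule: isqrt.induct)
  case (1 n)
  show ?case
  proof (cases "n = 0")
    case True
    then show ?thesis by (simp add: isqrt.simps)
  next
    case False
    define k where "k = isqrt (n div 4)"
    have IH: "0 \<le> k" "k * k \<le> n div 4" "n div 4 < (k + 1) * (k + 1)"
      using 1 False by (auto simp: k_def)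
    from IH(2) have "4 * (k * k) \<le> n" by linarith
    moreover from IH(3) have "n < 4 * ((k + 1) * (k + 1))" by linarith
    moreover have "isqrt n = (if (2 * k + 1) * (2 * k + 1) \<le> n then 2 * k + 1 else 2 * k)"
      using False 1(2) by (subst isqrt.simps) (simp add: k_def Let_def)
    ultimately show ?thesis using IH(1) by (simp add: algebra_simps)
  qed
qed

lemma isqrt_ge_iff:
  assumes "0 \<le> n"
  shows "y * y \<le> n \<longleftrightarrow> \<bar>y\<bar> \<le> isqrt n"
proof
  assume "y * y \<le> n"
  then have "\<bar>y\<bar> * \<bar>y\<bar> < (isqrt n + 1) * (isqrt n + 1)" using isqrt_bounds[OF assms] by simp
  then show "\<bar>y\<bar> \<le> isqrt n"
    using isqrt_bounds[OF assms] mult_mono[of "isqrt n + 1" "\<bar>y\<bar>" "isqrt n + 1" "\<bar>y\<bar>"] by linarith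
next
  assume "\<bar>y\<bar> \<le> isqrt n"
  then have "\<bar>y\<bar> * \<bar>y\<bar> \<le> isqrt n * isqrt n" by (intro mult_mono) auto
  then show "y * y \<le> n" using isqrt_bounds[OF assms] by simp
qed

text \<open>
  \<open>attains R xs s\<close> asks whether the rows \<open>R\<close>, listed from the last variable to the first, can
  add up to exactly \<open>s\<close> when the variables after them have the values \<open>xs\<close>; \<open>attains_from\<close> tries
  the values from \<open>y\<close> to \<open>u\<close> for the variable of a row. For the first variable no loop is needed,
  since \<open>s\<close> must be \<open>f\<close> times a perfect square.

  Conditionals take the place of the logical connectives because rewriting evaluates only the branch
  that is selected, whereas it normalises both sides of a disjunction: the search has to stop at the
  first hit.
\<close>
function attains :: "squares \<Rightarrow> int list \<Rightarrow> int \<Rightarrow> bool"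
  and attains_from :: "int \<Rightarrow> int \<Rightarrow> int \<Rightarrow> squares \<Rightarrow> int list \<Rightarrow> int \<Rightarrow> int \<Rightarrow> int \<Rightarrow> bool"
where
  "attains [] xs s = (s = 0)"
| "attains ((f, m, b) # R) xs s =
    (let l = linear_form b xs; k = isqrt (s div f) in
     if R = [] then
       if f * k * k = s then if (k - l) mod m = 0 then True else (k + l) mod m = 0 else False
     else attains_from f m l R xs s (- ((k + l) div m)) ((k - l) div m))"
| "attains_from f m l R xs s y u =
    (if u < y then False
     else if attains R (y # xs) (s - f * (m * y + l) * (m * y + l)) then True
     else attains_from f m l R xs s (y + 1) u)"
  by pat_completeness auto
termination
  by (relation "measures
        [\<lambda>z. case z of Inl (R, xs, s) \<Rightarrow> 2 * length R
            | Inr (f, m, l, R, xs, s, y, u) \<Rightarrow> 2 * length R + 1,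
         \<lambda>z. case z of Inl _ \<Rightarrow> 0 | Inr (f, m, l, R, xs, s, y, u) \<Rightarrow> nat (u + 1 - y)]") auto

declare attains.simps [simp del] attains_from.simps [simp del]

lemma int_le_div_iff:
  fixes m :: int
  assumes "0 < m"
  shows "y \<le> k div m \<longleftrightarrow> m * y \<le> k"
proof
  assume "y \<le> k div m"
  then have "m * y \<le> m * (k div m)" using assms by simp
  also have "\<dots> \<le> k" using assms by (simp add: minus_mod_eq_mult_div [symmetric])
  finally show "m * y \<le> k" .
next
  assume "m * y \<le> k"
  then show "y \<le> k div m" using zdiv_mono1[of "m * y" k m] assms by simp
qed

text \<open>
  The interval of values that \<open>attains\<close> tries for a variable is the exact solution set of the
  inequality that its square has to satisfy.
\<close>
lemma abs_linear_le_iff: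
  fixes m :: int
  assumes "0 < m"
  shows "\<bar>m * y + l\<bar> \<le> k \<longleftrightarrow> - ((k + l) div m) \<le> y \<and> y \<le> (k - l) div m"
  using int_le_div_iff[OF assms, of y "k - l"] int_le_div_iff[OF assms, of "- y" "k + l"]
  by (auto simp: abs_le_iff minus_le_iff)

lemma attains_from_iff:
  "attains_from f m l R xs s y u \<longleftrightarrow>
     (\<exists>z. y \<le> z \<and> z \<le> u \<and> attains R (z # xs) (s - f * (m * z + l)^2))"
proof (induction "nat (u + 1 - y)" arbitrary: y)
  case 0
  then show ?case by (subst attains_from.simps) auto
next
  case (Suc k)
  then have IH: "attains_from f m l R xs s (y + 1) u \<longleftrightarrow>
     (\<exists>z. y + 1 \<le> z \<and> z \<le> u \<and> attains R (z # xs) (s - f * (m * z + l)^2))" and "y \<le> u" by auto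
  show ?case
    using \<open>y \<le> u\<close> by (subst attains_from.simps)
      (auto simp: IH power2_eq_square mult.assoc; metis add1_zle_eq order_le_less order_refl)
qed

lemma sum_squares_append:
  "length ys = length D \<Longrightarrow> 
   sum_squares (D @ E) (ys @ xs) = sum_squares D (ys @ xs) + sum_squares E xs"
  by (induction D ys rule: list_induct2') auto


lemma isqrt_square: "isqrt (z * z) = \<bar>z\<bar>"
proof (rule antisym)
  show "\<bar>z\<bar> \<le> isqrt (z * z)" using isqrt_ge_iff[of "z * z" z] by simp
  have "isqrt (z * z) * isqrt (z * z) \<le> \<bar>z\<bar> * \<bar>z\<bar>" "0 \<le> isqrt (z * z)"
    using isqrt_bounds[of "z * z"] by auto
  then show "isqrt (z * z) \<le> \<bar>z\<bar>" using abs_le_square_iff[of "isqrt (z * z)" z]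
    by (simp add: power2_eq_square)
qed

text \<open>
  Induction over the rows. The search restricts the variable of a row to \<open>f (m y + l)^2 \<le> s\<close>;
  nothing is lost, since the remaining squares are nonnegative and must sum to
  \<open>s - f (m y + l)^2\<close>. For the last remaining row this difference must be zero, and the two signs
  of the root give the two divisibility tests.
\<close>
lemma attains_iff:
  assumes "positive_squares R"
  shows "attains R xs s \<longleftrightarrow> (\<exists>ys. length ys = length R \<and> sum_squares (rev R) (ys @ xs) = s)"
  using assms
proof (induction R arbitrary: xs s)
  case Nil
  then show ?case by (auto simp: attains.simps)
next
  case (Cons r R)
  obtain f m b where r: "r = (f, m, b)" by (cases r)
  have R: "positive_squares R" and pos: "f > 0" "m > 0"
    using Cons.prems by (auto simp: positive_squares_def r)
  define l where "l = linear_form b xs"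
  have split: "sum_squares (rev (r # R)) ((ys @ [y]) @ xs) =
      sum_squares (rev R) (ys @ y # xs) + f * (m * y + l)^2" if "length ys = length R" for ys y
    using sum_squares_append[of ys "rev R" "[(f, m, b)]" "y # xs"] that by (simp add: r l_def)
  have "(\<exists>ys. length ys = length (r # R) \<and> sum_squares (rev (r # R)) (ys @ xs) = s) \<longleftrightarrow>
      (\<exists>y ys. length ys = length R \<and> sum_squares (rev R) (ys @ y # xs) = s - f * (m * y + l)^2)"
    (is "?represented \<longleftrightarrow> _")
  proof
    assume ?represented
    then obtain zs where zs: "length zs = length (r # R)" "sum_squares (rev (r # R)) (zs @ xs) = s"
      by auto
    then obtain y ys where "zs = ys @ [y]" by (cases zs rule: rev_cases) auto
    then show "\<exists>y ys. length ys = length R \<and> sum_squares (rev R) (ys @ y # xs) = s - f * (m * y + l)^2"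
      using zs split[of ys y] by (intro exI[of _ y] exI[of _ ys]) auto
  next
    assume "\<exists>y ys. length ys = length R \<and> sum_squares (rev R) (ys @ y # xs) = s - f * (m * y + l)^2"
    then obtain y ys where "length ys = length R"
      "sum_squares (rev R) (ys @ y # xs) = s - f * (m * y + l)^2" by auto
    then show ?represented using split[of ys y] by (intro exI[of _ "ys @ [y]"]) auto
  qed
  also have "\<dots> \<longleftrightarrow> (\<exists>y. attains R (y # xs) (s - f * (m * y + l)^2))"
    using Cons.IH[OF R] by simp
  also have "\<dots> \<longleftrightarrow> attains (r # R) xs s"
  proof (cases "R = []")
    case True
    define k where "k = isqrt (s div f)"
    have "(\<exists>y. f * (m * y + l)^2 = s) \<longleftrightarrow> f * k * k = s \<and> (m dvd k - l \<or> m dvd k + l)"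
    proof
      assume "\<exists>y. f * (m * y + l)^2 = s"
      then obtain y where y: "f * (m * y + l)^2 = s" by auto
      then have "s div f = (m * y + l) * (m * y + l)" using pos by (auto simp: power2_eq_square)
      then have k: "k = \<bar>m * y + l\<bar>" by (simp add: k_def isqrt_square)
      then have "k - l = m * y \<or> k + l = m * (- y)" by auto
      then show "f * k * k = s \<and> (m dvd k - l \<or> m dvd k + l)"
        using y k by (auto simp: power2_eq_square mult.assoc)
    next
      assume *: "f * k * k = s \<and> (m dvd k - l \<or> m dvd k + l)"
      then consider y where "k - l = m * y" | y where "k + l = m * y" by (auto elim!: dvdE)
      then show "\<exists>y. f * (m * y + l)^2 = s"
      proof cases
        case (1 y)
        then have "m * y + l = k" by simp
        then show ?thesis using * by (intro exI[of _ y]) (simp add: power2_eq_square mult.assoc)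
      next
        case (2 y)
        then have "m * (- y) + l = - k" by simp
        then show ?thesis using *
          by (intro exI[of _ "- y"]) (simp only: power2_minus, simp add: power2_eq_square mult.assoc)
      qed
    qed
    then show ?thesis
      by (auto simp: True r attains.simps l_def k_def Let_def dvd_eq_mod_eq_0 eq_commute[of s])
  next
    case False
    have "\<bar>m * y + l\<bar> \<le> isqrt (s div f)" if hit: "attains R (y # xs) (s - f * (m * y + l)^2)" for y
    proof -
      have "0 \<le> s - f * (m * y + l)^2"
      proof -
        obtain ys where "sum_squares (rev R) (ys @ y # xs) = s - f * (m * y + l)^2"
          using hit Cons.IH[OF R] by auto
        moreover have "positive_squares (rev R)" using R by (simp add: positive_squares_def)
        ultimately show ?thesis using sum_squares_nonneg[of "rev R" "ys @ y # xs"] by simp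
      qed
      then have "(m * y + l) * (m * y + l) \<le> s div f"
        using pos by (simp add: int_le_div_iff power2_eq_square)
      moreover from this have "0 \<le> s div f" by (rule order_trans[rotated]) simp
      ultimately show ?thesis using isqrt_ge_iff by blast
    qed
    moreover have "attains (r # R) xs s \<longleftrightarrow>
        (\<exists>y. \<bar>m * y + l\<bar> \<le> isqrt (s div f) \<and> attains R (y # xs) (s - f * (m * y + l)^2))"
      using False by (simp add: r attains.simps Let_def attains_from_iff abs_linear_le_iff[OF pos(2)]
          conj_assoc flip: l_def)
    ultimately show ?thesis by blast
  qed
  finally show ?case by simp
qed

section \<open>A diagonal form for the integers above a bound\<close>

definition diagonal :: "int list \<Rightarrow> coeffs" where
  "diagonal cs = map (\<lambda>c. (c, [])) cs"

lemma length_diagonal [simp]: "length (diagonal cs) = length cs"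
  by (simp add: diagonal_def)

text \<open>
  The diagonal block comes first: a row refers only to later variables and the rows of a diagonal
  form are empty, so the coefficients of \<open>q\<close> need no shifting.
\<close>
lemma quad_form_diagonal_append:
  "length ys = length cs \<Longrightarrow>
     quad_form (diagonal cs @ q) (ys @ xs) = quad_form (diagonal cs) ys + quad_form q xs"
  by (induction ys cs rule: list_induct2) (auto simp: diagonal_def)

lemma quad_form_diagonal_zero_or_ge:
  assumes "\<forall>c\<in>set cs. M \<le> c" "0 < M"
  shows "quad_form (diagonal cs) ys = 0 \<or> M \<le> quad_form (diagonal cs) ys"
  using assms(1)
proof (induction cs arbitrary: ys)
  case (Cons c cs)
  show ?case
  proof (cases ys)
    case (Cons y zs)
    have "y^2 = 0 \<or> 1 \<le> y^2" by (auto simp: int_one_le_iff_zero_less)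
    moreover have "c * 1 \<le> c * y^2" if "1 \<le> y^2" using that Cons.prems assms(2) by (intro mult_left_mono) auto
    ultimately have "c * y^2 = 0 \<or> M \<le> c * y^2" using Cons.prems by force
    then show ?thesis using Cons.IH[of zs] Cons.prems assms(2) by (auto simp: Cons diagonal_def)
  qed (auto simp: diagonal_def)
qed (auto simp: diagonal_def)

lemma quad_form_diagonal_definite:
  fixes ys :: "real list"
  assumes "\<forall>c\<in>set cs. 0 < c" "length ys = length cs"
  shows "0 \<le> quad_form (diagonal cs) ys"
    and "quad_form (diagonal cs) ys = 0 \<Longrightarrow> set ys \<subseteq> {0}"
proof -
  have "0 \<le> quad_form (diagonal cs) ys \<and> (quad_form (diagonal cs) ys = 0 \<longrightarrow> set ys \<subseteq> {0})"
    using assms(2,1)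
  proof (induction ys cs rule: list_induct2)
    case (Cons y ys c cs)
    then have "0 \<le> of_int c * y^2" "0 \<le> quad_form (diagonal cs) ys" by auto
    then show ?case using Cons by (auto simp: diagonal_def add_nonneg_eq_0_iff)
  qed (auto simp: diagonal_def)
  then show "0 \<le> quad_form (diagonal cs) ys"
    and "quad_form (diagonal cs) ys = 0 \<Longrightarrow> set ys \<subseteq> {0}" by auto
qed

lemma diagonal_represents_zero:
  "\<exists>ys. length ys = length cs \<and> quad_form (diagonal cs) ys = (0::int)"
proof (induction cs)
  case (Cons c cs)
  then obtain ys where "length ys = length cs" "quad_form (diagonal cs) ys = (0::int)" by auto
  then show ?case by (intro exI[of _ "0 # ys"]) (auto simp: diagonal_def)
qed auto

lemma diagonal_represents_coefficient:
  assumes "c \<in> set cs"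
  shows "\<exists>ys. length ys = length cs \<and> quad_form (diagonal cs) ys = c"
  using assms
proof (induction cs)
  case (Cons d cs)
  show ?case
  proof (cases "c = d")
    case True
    obtain ys where "length ys = length cs" "quad_form (diagonal cs) ys = (0::int)"
      using diagonal_represents_zero by blast
    then show ?thesis using True by (intro exI[of _ "1 # ys"]) (auto simp: diagonal_def)
  next
    case False
    then obtain ys where "length ys = length cs" "quad_form (diagonal cs) ys = c"
      using Cons by auto
    then show ?thesis by (intro exI[of _ "0 # ys"]) (auto simp: diagonal_def)
  qed
qed auto

definition tail_coefficients :: "int \<Rightarrow> int list" where
  "tail_coefficients t = replicate 4 (t + 1) @ [t + 2..2 * t + 1]"


lemma tail_coefficients_ge: "c \<in> set (tail_coefficients t) \<Longrightarrow> t + 1 \<le> c"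
  by (auto simp: tail_coefficients_def)

text \<open>
  Write \<open>n = (t + 1) k + r\<close> with \<open>0 \<le> r \<le> t\<close> and \<open>k \<ge> 1\<close>. If \<open>r = 0\<close>, the four squares
  supply \<open>k\<close>; otherwise they supply \<open>k - 1\<close>, and the coefficient \<open>t + 1 + r\<close> supplies the rest.
\<close>
lemma tail_coefficients_represent:
  assumes "0 < t" "t < n"
  shows "\<exists>ys. length ys = length (tail_coefficients t) \<and> quad_form (diagonal (tail_coefficients t)) ys = n"
proof -
  define k where "k = n div (t + 1)"
  define r where "r = n mod (t + 1)"
  have n: "n = (t + 1) * k + r" by (simp add: k_def r_def)
  have r: "0 \<le> r" "r \<le> t" using assms using pos_mod_bound[of "t + 1" n] by (auto simp: r_def)
  have "1 \<le> k" unfolding k_def using assms by (subst int_le_div_iff) auto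
  have combine: ?thesis
    if j: "0 \<le> j" and ys: "length ys = nat t" "quad_form (diagonal [t + 2..2 * t + 1]) ys = n - (t + 1) * j" for j ys
  proof -
    obtain a b c d where "j = a^2 + b^2 + c^2 + d^2"
      using lagrange_four_squares[OF j] unfolding sum_of_four_squares_def by auto
    then have "quad_form (diagonal (tail_coefficients t)) ([a, b, c, d] @ ys) = n"
      using ys(2) by (simp add: tail_coefficients_def diagonal_def numeral_eq_Suc algebra_simps)
    then show ?thesis using ys(1) by (intro exI[of _ "[a, b, c, d] @ ys"]) (simp add: tail_coefficients_def)
  qed
  show ?thesis
  proof (cases "r = 0")
    case True
    then show ?thesis using diagonal_represents_zero[of "[t + 2..2 * t + 1]"] combine[of k] n \<open>1 \<le> k\<close>
      by auto
  next
    case False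
    then have "t + 1 + r \<in> set [t + 2..2 * t + 1]" using r by auto
    from diagonal_represents_coefficient[OF this] show ?thesis
      using combine[of "k - 1"] n \<open>1 \<le> k\<close> by (auto simp: algebra_simps)
  qed
qed

section \<open>Forms with a single exception\<close>

definition definite :: "coeffs \<Rightarrow> bool" where
  "definite q \<longleftrightarrow> (\<forall>xs :: real list. length xs = length q \<longrightarrow>
     0 \<le> quad_form q xs \<and> (quad_form q xs = 0 \<longrightarrow> set xs \<subseteq> {0}))"

lemma positive_definite_real_form:
  assumes "definite q"
  shows "positive_definite (length q) (real_form q)"
  unfolding positive_definite_def
proof (intro ballI impI)
  fix x :: "real vec" assume x: "x \<in> carrier_vec (length q)" "x \<noteq> 0\<^sub>v (length q)"
  have "\<not> set (list_of_vec x) \<subseteq> {0}"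
  proof
    assume *: "set (list_of_vec x) \<subseteq> {0}"
    have "x = 0\<^sub>v (length q)"
    proof (rule eq_vecI)
      fix i assume "i < dim_vec (0\<^sub>v (length q) :: real vec)"
      then have "i < dim_vec x" using x(1) by auto
      then have "list_of_vec x ! i \<in> set (list_of_vec x)" by (intro nth_mem) simp
      then show "x $ i = 0\<^sub>v (length q) $ i"
        using * \<open>i < dim_vec x\<close> x(1) by (auto simp: list_of_vec_index)
    qed (use x(1) in auto)
    then show False using x(2) by simp
  qed
  moreover have "length (list_of_vec x) = length q" using x(1) by simp
  ultimately show "0 < real_form q x"
    using assms unfolding definite_def real_form_def by (metis order_le_less)
qed

text \<open>
  Adding the diagonal form for the integers above \<open>t\<close> to a form that is correct up to \<open>t\<close>: a
  nonzero value of the diagonal part already exceeds \<open>t\<close>, so no new representation of \<open>t\<close> arises.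
\<close>
lemma single_exception_form:
  assumes "0 < t" "definite q"
    and missed: "\<nexists>xs. length xs = length q \<and> quad_form q xs = t"
    and small: "\<And>n. 0 < n \<Longrightarrow> n < t \<Longrightarrow> gcd n 3 = 1 \<Longrightarrow>
      \<exists>xs. length xs = length q \<and> quad_form q xs = n"
  shows "\<exists>r Q. integer_valued_quadratic_form r Q \<and> positive_definite r Q \<and> \<not> represents r Q t \<and>
    (\<forall>n. n > 0 \<and> n \<noteq> t \<and> gcd n 3 = 1 \<longrightarrow> represents r Q n)"
proof -
  define cs where "cs = tail_coefficients t"
  define p where "p = diagonal cs @ q"
  have len: "length p = length cs + length q" by (simp add: p_def)
  have cs: "\<forall>c\<in>set cs. t + 1 \<le> c" by (auto simp: cs_def tail_coefficients_ge)
  have split: "\<exists>ys zs. xs = ys @ zs \<and> length ys = length cs \<and> length zs = length q \<and>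
      quad_form p xs = quad_form (diagonal cs) ys + quad_form q zs"
    if "length xs = length p" for xs :: "'a::comm_ring_1 list"
    using that quad_form_diagonal_append[of "take (length cs) xs" cs q "drop (length cs) xs"]
    by (intro exI[of _ "take (length cs) xs"] exI[of _ "drop (length cs) xs"]) (auto simp: p_def len)
  have "definite p"
    unfolding definite_def
  proof (intro allI impI)
    fix xs :: "real list" assume "length xs = length p"
    then obtain ys zs where xs: "xs = ys @ zs" "length ys = length cs" "length zs = length q"
      "quad_form p xs = quad_form (diagonal cs) ys + quad_form q zs" using split by blast
    have "\<forall>c\<in>set cs. 0 < c" using cs assms(1) by auto
    note diag = quad_form_diagonal_definite[OF this xs(2)]
    have "0 \<le> quad_form q zs" "quad_form q zs = 0 \<longrightarrow> set zs \<subseteq> {0}"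
      using assms(2) xs(3) by (auto simp: definite_def)
    then show "0 \<le> quad_form p xs \<and> (quad_form p xs = 0 \<longrightarrow> set xs \<subseteq> {0})"
      using diag xs by (auto simp: add_nonneg_eq_0_iff)
  qed
  moreover have "\<not> represents (length p) (real_form p) t"
  proof
    assume "represents (length p) (real_form p) t"
    then obtain xs where "length xs = length p" "quad_form p xs = t"
      by (auto simp: represents_real_form_iff)
    then obtain ys zs where xs: "length zs = length q"
      "t = quad_form (diagonal cs) ys + quad_form q zs" using split[of xs] by auto
    have "real_of_int (quad_form q zs) = quad_form q (map real_of_int zs)"
      by (simp add: quad_form_of_int)
    moreover have "0 \<le> quad_form q (map real_of_int zs)"
      using assms(2) xs(1) by (auto simp: definite_def)
    ultimately have "0 \<le> quad_form q zs" by simp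
    then have "quad_form (diagonal cs) ys = 0"
      using quad_form_diagonal_zero_or_ge[OF cs, of ys] assms(1) xs(2) by auto
    then show False using missed xs by auto
  qed
  moreover have "represents (length p) (real_form p) n" if n: "n > 0" "n \<noteq> t" "gcd n 3 = 1" for n
  proof -
    have "\<exists>ys zs. length ys = length cs \<and> length zs = length q \<and>
        quad_form (diagonal cs) ys + quad_form q zs = n"
    proof (cases "n < t")
      case True
      obtain ys where "length ys = length cs" "quad_form (diagonal cs) ys = (0::int)"
        using diagonal_represents_zero by blast
      moreover obtain zs where "length zs = length q" "quad_form q zs = n"
        using small[OF n(1) True n(3)] by blast
      ultimately show ?thesis by (intro exI[of _ ys] exI[of _ zs]) simp
    next
      case False
      then obtain ys where ys: "length ys = length cs" "quad_form (diagonal cs) ys = n"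
        using tail_coefficients_represent[of t n] assms(1) n(2) by (auto simp: cs_def)
      have "quad_form q (replicate (length q) (0::int)) = 0"
        by (rule quad_form_zero) auto
      then show ?thesis using ys by (intro exI[of _ ys] exI[of _ "replicate (length q) 0"]) simp
    qed
    then obtain ys zs where "length ys = length cs" "length zs = length q"
      "quad_form (diagonal cs) ys + quad_form q zs = n" by blast
    then have "length (ys @ zs) = length p" "quad_form p (ys @ zs) = n"
      by (simp_all add: p_def quad_form_diagonal_append)
    then show ?thesis unfolding represents_real_form_iff by blast
  qed
  ultimately show ?thesis
    using integer_valued_real_form[of p] positive_definite_real_form[of p]
    by (intro exI[of _ "length p"] exI[of _ "real_form p"]) auto
qed

text \<open>
  The form \<open>q\<close> in question is \<open>expand D\<close> divided by \<open>N\<close>; the condition on \<open>expand D\<close> says that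
  all its coefficients are divisible by \<open>N\<close>. As in the search, the inner conditional saves an
  evaluation: nothing is searched for multiples of 3.
\<close>
definition exception_certificate :: "int \<Rightarrow> int \<Rightarrow> squares \<Rightarrow> bool" where
  "exception_certificate t N D \<longleftrightarrow>
     0 < t \<and> 0 < N \<and> positive_squares D \<and>
     expand D = scale_coeffs N (div_coeffs N (expand D)) \<and>
     (let R = rev D in
        \<not> attains R [] (N * t) \<and>
        list_all (\<lambda>n. if n mod 3 = 0 then True else attains R [] (N * n)) [1..t - 1])"

lemma exception_certificate_sound:
  assumes "exception_certificate t N D"
  shows "\<exists>r Q. integer_valued_quadratic_form r Q \<and> positive_definite r Q \<and> \<not> represents r Q t \<and>
    (\<forall>n. n > 0 \<and> n \<noteq> t \<and> gcd n 3 = 1 \<longrightarrow> represents r Q n)"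
proof -
  define q where "q = div_coeffs N (expand D)"
  have t: "0 < t" and N: "0 < N" and D: "positive_squares D" and eq: "expand D = scale_coeffs N q"
    and miss: "\<not> attains (rev D) [] (N * t)"
    and hit: "list_all (\<lambda>n. if n mod 3 = 0 then True else attains (rev D) [] (N * n)) [1..t - 1]"
    using assms unfolding exception_certificate_def Let_def q_def by blast+
  have len: "length q = length D" by (simp add: q_def div_coeffs_def)
  have squares: "of_int N * quad_form q xs = sum_squares D xs" if "length xs = length q"
    for xs :: "'a::comm_ring_1 list"
    using quad_form_expand[of xs D] that by (simp add: eq quad_form_scale len)
  have squares_int: "N * quad_form q xs = sum_squares D xs" if "length xs = length q" for xs
    using squares[OF that] by simp
  have attains: "attains (rev D) [] (N * n) \<longleftrightarrow> (\<exists>xs. length xs = length q \<and> quad_form q xs = n)" for n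
  proof -
    have "positive_squares (rev D)" using D by (simp add: positive_squares_def)
    then have "attains (rev D) [] (N * n) \<longleftrightarrow> (\<exists>xs. length xs = length q \<and> sum_squares D xs = N * n)"
      by (simp add: attains_iff len)
    also have "\<dots> \<longleftrightarrow> (\<exists>xs. length xs = length q \<and> quad_form q xs = n)"
      using squares_int N by (metis mult_cancel_left less_irrefl)
    finally show ?thesis .
  qed
  have "definite q"
    unfolding definite_def
  proof (intro allI impI)
    fix xs :: "real list" assume len': "length xs = length q"
    have "0 \<le> of_int N * quad_form q xs"
      using sum_squares_nonneg[OF D, of xs] by (simp add: squares[OF len'])
    moreover have "set xs \<subseteq> {0}" if "quad_form q xs = 0"
      using sum_squares_eq_zeroD[OF D, of xs] that squares[OF len'] len' len by simp
    ultimately show "0 \<le> quad_form q xs \<and> (quad_form q xs = 0 \<longrightarrow> set xs \<subseteq> {0})"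
      using N by (simp add: zero_le_mult_iff)
  qed
  moreover have "\<nexists>xs. length xs = length q \<and> quad_form q xs = t"
    using miss by (simp add: attains)
  moreover have "\<exists>xs. length xs = length q \<and> quad_form q xs = n" if "0 < n" "n < t" "gcd n 3 = 1" for n
  proof -
    have "n mod 3 \<noteq> 0" using that(3) by (auto simp: mod_eq_0_iff_dvd gcd.commute dest: gcd_nat.absorb1)
    moreover have "n \<in> set [1..t - 1]" using that by auto
    ultimately have "attains (rev D) [] (N * n)" using hit unfolding list_all_iff by metis
    then show ?thesis by (simp add: attains)
  qed
  ultimately show ?thesis using single_exception_form[OF t] by blast
qed

section \<open>The thirty-one certificates\<close>

text \<open>
  The forms were found by escalation. For \<open>t = 1\<close> no variable is needed; otherwise start with
  \<open>x^2\<close> and, as long as the least missed integer \<open>n\<close> prime to 3 is not the desired \<open>t\<close>,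
  pass to a form in further variables that represents \<open>n\<close> but still misses \<open>t\<close>. For example,
  \<open>t = 29\<close> has \<open>8 q = 2 (2 x + z)^2 + (4 y - z)^2 + 29 z^2\<close>, that is,
  \<open>q = x^2 + x z + 2 y^2 - y z + 4 z^2\<close>, and the forms for 145, 203 and 290 arise from it by
  adjoining \<open>29 u^2\<close>, then \<open>58 v^2\<close> or \<open>87 v^2\<close>. The order of the variables was chosen to
  keep the search short.
\<close>

lemma certificate_1: "exception_certificate 1 1 []"
  by code_simp

lemma certificate_2: "exception_certificate 2 1 [(1, 1, [])]"
  by code_simp

lemma certificate_5: "exception_certificate 5 4 [(1, 2, [1]), (7, 1, [])]"
  by code_simp

lemma certificate_7: "exception_certificate 7 1 [(1, 1, []), (1, 1, [])]"
  by code_simp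

lemma certificate_10: "exception_certificate 10 8 [(8, 1, []), (1, 4, [1]), (15, 1, [])]"
  by code_simp

lemma certificate_11: "exception_certificate 11 4 [(4, 1, []), (1, 2, [1]), (23, 1, [])]"
  by code_simp

lemma certificate_13: "exception_certificate 13 8 [(8, 1, []), (1, 4, [1]), (39, 1, [])]"
  by code_simp

lemma certificate_14: "exception_certificate 14 1 [(1, 1, []), (2, 1, []), (1, 1, [])]"
  by code_simp

lemma certificate_17: "exception_certificate 17 28 [(7, 2, [1, 1]), (1, 7, [-3]), (68, 1, [])]"
  by code_simp

lemma certificate_19:
  "exception_certificate 19 8 [(2, 2, [1]), (14, 1, []), (3, 4, [1]), (29, 1, [])]"
  by code_simp

lemma certificate_22: "exception_certificate 22 4 [(1, 2, [1]), (11, 1, []), (4, 1, [])]"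
  by code_simp

lemma certificate_23: "exception_certificate 23 12 [(12, 1, []), (1, 6, [1]), (23, 1, [])]"
  by code_simp

lemma certificate_26:
  "exception_certificate 26 20 [(5, 2, [0, 1]), (1, 10, [0, 1]), (35, 1, []), (99, 1, [])]"
  by code_simp

lemma certificate_29: "exception_certificate 29 8 [(2, 2, [0, 1]), (1, 4, [-1]), (29, 1, [])]"
  by code_simp

lemma certificate_31: "exception_certificate 31 8 [(8, 1, []), (1, 4, [1]), (31, 1, [])]"
  by code_simp

lemma certificate_34:
  "exception_certificate 34 28 [(7, 2, [1, 1]), (1, 7, [-3]), (68, 1, []), (476, 1, [])]"
  by code_simp

lemma certificate_35: "exception_certificate 35 4 [(1, 2, [0, 1]), (4, 1, []), (7, 1, [])]"
  by code_simp

lemma certificate_37: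
  "exception_certificate 37 296 [(74, 2, [0, 1]), (37, 4, [-1, 1]), (1, 37, [1]), (8546, 1, [])]"
  by code_simp

lemma certificate_38:
  "exception_certificate 38 4 [(4, 1, []), (1, 2, [1]), (19, 1, []), (64, 1, [])]"
  by code_simp

lemma certificate_46:
  "exception_certificate 46 4 [(1, 2, [0, 0, 1]), (1, 2, [0, 1]), (52, 1, []), (18, 1, [])]"
  by code_simp

lemma certificate_47:
  "exception_certificate 47 4 [(4, 1, []), (1, 2, [1]), (23, 1, []), (36, 1, [])]"
  by code_simp

lemma certificate_55:
  "exception_certificate 55 4 [(4, 1, []), (1, 2, [0, 1]), (7, 2, [1]), (24, 1, [])]"
  by code_simp

lemma certificate_58:
  "exception_certificate 58 8 [(2, 2, [0, 0, 1]), (1, 4, [0, -1]), (6, 2, [-1]), (55, 1, [])]"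
  by code_simp

lemma certificate_62:
  "exception_certificate 62 4 [(1, 2, [0, 0, 1]), (1, 2, [0, 1]), (56, 1, []), (18, 1, [])]"
  by code_simp

lemma certificate_70:
  "exception_certificate 70 8 [(8, 1, []), (1, 4, [0, 1]), (224, 1, []), (7, 1, [])]"
  by code_simp

lemma certificate_94:
  "exception_certificate 94 4 [(1, 2, [0, 1, 1]), (1, 2, [1, 1]), (46, 1, []), (18, 1, [])]"
  by code_simp

lemma certificate_110:
  "exception_certificate 110 4 [(4, 1, []), (1, 2, [1]), (11, 1, []), (88, 1, [])]"
  by code_simp

lemma certificate_119:
  "exception_certificate 119 4 [(1, 2, [0, 0, 0, 0, 1]), (1, 2, [0, 0, 0, 1]), (7, 2, [1, 0, -1]), (1, 7, [0, -1]), (35, 2, [1]), (139, 1, [])]"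
  by code_simp

lemma certificate_145:
  "exception_certificate 145 8 [(2, 2, [0, 1]), (1, 4, [-1]), (29, 1, []), (232, 1, [])]"
  by code_simp

lemma certificate_203:
  "exception_certificate 203 8 [(2, 2, [0, 1]), (1, 4, [-1]), (29, 1, []), (232, 1, []), (464, 1, [])]"
  by code_simp

lemma certificate_290:
  "exception_certificate 290 8 [(2, 2, [0, 0, 1]), (1, 4, [0, -1]), (232, 1, []), (29, 1, []), (696, 1, [])]"
  by code_simp

lemmas certificates =
  certificate_1 certificate_2 certificate_5 certificate_7 certificate_10 certificate_11
  certificate_13 certificate_14 certificate_17 certificate_19 certificate_22 certificate_23
  certificate_26 certificate_29 certificate_31 certificate_34 certificate_35 certificate_37
  certificate_38 certificate_46 certificate_47 certificate_55 certificate_58 certificate_62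
  certificate_70 certificate_94 certificate_110 certificate_119 certificate_145 certificate_203
  certificate_290

theorem corollary2:
  fixes t :: int
  assumes "t \<in> {1, 2, 5, 7, 10, 11, 13, 14, 17, 19, 22, 23, 26, 29, 31, 34, 35, 37, 38, 46, 47,
                55, 58, 62, 70, 94, 110, 119, 145, 203, 290}"
  shows "\<exists>(r :: nat) (Q :: real vec \<Rightarrow> real).
           integer_valued_quadratic_form r Q \<and> positive_definite r Q \<and>
           \<not> represents r Q t \<and>
           (\<forall>n :: int. n > 0 \<and> n \<noteq> t \<and> gcd n 3 = 1 \<longrightarrow> represents r Q n)"
proof -
  have "\<exists>N D. exception_certificate t N D"
    using assms
    by (elim insertE emptyE; simp only:) (rule exI, rule exI, rule certificates)+
  then show ?thesis using exception_certificate_sound by blast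
qed

end
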